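(* Let $a\in\mathcal{P}$ and $S\in\mathcal{S}$. The Ricci operator $\operatorname{ric}_S\in\mathfrak{gl}(T)$ of the metric $S$ on the Lie algebra $T_a$ satisfies \[\langle\operatorname{ric}_S,X\rangle=\tfrac14\langle Xa,q(a,S)\rangle\quad\text{for all }X\in\mathfrak{gl}(T).\] Moreover, \[\langle\operatorname{ric}_S,X\rangle=-\tfrac12(X^+s)(a,S)\quad\text{for all }X\in\mathfrak{gl}(T).\]
   Context: Let $T=\mathbb{R}^n$ with standard basis $e_1,\dots,e_n$ and dual basis $e^1,\dots,e^n$; repeated indices are summed. $V^{11}_1\subset T^*\otimes\operatorname{End}T$ is the space of linear maps $a\colon T\to\operatorname{End}(T)$, written $a=e^i\otimes a_i$ with $a_i=a(e_i)$, such that $a(v)w=-a(w)v$ and $\operatorname{tr}a(v)=0$ for all $v,w\in T$. Dually, identifying $\operatorname{End}(T^* )$ with $\operatorname{End}(T)$ via transposition, $V^1_{11}\subset T\otimes\operatorname{End}T$ is the space of linear maps $b\colon T^*\to\operatorname{End}(T)$, written $b=e_i\otimes b_i$ with $b_i=b(e^i)$, such that ${}^tb(\alpha)\beta=-{}^tb(\beta)\alpha$ and $\operatorname{tr}b(\alpha)=0$ for all $\alpha,\beta\in T^*$. The natural duality $\langle\cdot,\cdot\rangle\colon V^{11}_1\times V^1_{11}\to\mathbb{R}$ is $\langle a,b\rangle=\sum_i\operatorname{tr}(a_i\circ b_i)$. On $\mathfrak{gl}(T)$ the pairing is $\langle A,X\rangle=\operatorname{tr}(AX)$. $\mathrm{GL}(T)$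 acts naturally on all tensor spaces (on $T^*$ by $g\alpha={}^tg^{-1}\alpha$, on $\operatorname{End}T$ by conjugation), hence on $V^{11}_1$ and $V^1_{11}$; $Xa$ denotes the induced infinitesimal action of $X\in\mathfrak{gl}(T)$. $\mathcal{P}\subset V^{11}_1$ is the set of those $a$ such that $[v,w]=a(v)w$ defines a Lie bracket on $T$ (necessarily unimodular) with Killing form zero; $T_a$ denotes this Lie algebra. $\mathcal{S}$ is the set of non-degenerate scalar products (of any signature) on $T$, identified with isomorphisms $S\colon T\to T^*$ with ${}^tS=S$. A scalar product $S$ is regarded as a metric on $T_a$, i.e. a left-invariant pseudoriemannian metric on a Lie group with Lie algebra $T_a$; its Ricci operator $\operatorname{ric}_S$ is then an element of $\mathfrak{gl}(T)$. The map $q\colon V^{11}_1\times\mathcal{S}\to V^1_{11}$ is $q(e^i\otimes a_i,S)=S^{-1}e^i\otimes S^{-1}\,{}^ta_i\,S$. The scalar curvature functional is $s\colon\mathcal{P}\times\mathcal{S}\to\mathbb{R}$, $s(a,S)=\operatorname{tr}\operatorname{ric}_S=-\frac14\langle a,q(a,S)\rangle$. $X^+$ denotes the fundamental vector field of $X\in\mathfrak{gl}(T)$ for the action $g(a,S)=(ga,S)$ of $\mathrm{GL}(T)$ on $V^{11}_1\times\mathcal{S}$, so that $(X^+s)(a,S)=\frac{d}{dt}\big|_{t=0}s(\exp(tX)a,S)$. *)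

theory Defs
  imports "HOL-Analysis.Analysis"
begin

text \<open>
  \<open>T\<close> is \<open>real^'n\<close>. A covector is represented by its coordinates in the dual basis, so \<open>T\<^sup>*\<close> is also
  \<open>real^'n\<close>, with evaluation \<open>\<alpha>(v) = \<alpha> \<bullet> v\<close>; the basis vector \<open>e\<^sub>i\<close> and the dual basis covector
  \<open>e\<^sup>i\<close> are both \<open>axis i 1\<close>. Linear maps among \<open>T\<close> and \<open>T\<^sup>*\<close> are matrices, and the transposed
  linear map has the transposed matrix.
\<close>

definition V11_1 :: "(real^'n \<Rightarrow> real^'n^'n) set" where
  "V11_1 = {a. linear a \<and> (\<forall>v w. a v *v w = - (a w *v v)) \<and> (\<forall>v. trace (a v) = 0)}"

definition V1_11 :: "(real^'n \<Rightarrow> real^'n^'n) set" where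
  "V1_11 = {b. linear b \<and> (\<forall>\<alpha> \<beta>. transpose (b \<alpha>) *v \<beta> = - (transpose (b \<beta>) *v \<alpha>))
             \<and> (\<forall>\<alpha>. trace (b \<alpha>) = 0)}"

definition duality :: "(real^'n \<Rightarrow> real^'n^'n) \<Rightarrow> (real^'n \<Rightarrow> real^'n^'n) \<Rightarrow> real" where
  "duality a b = (\<Sum>i\<in>UNIV. trace (a (axis i 1) ** b (axis i 1)))"

definition gl_pairing :: "real^'n^'n \<Rightarrow> real^'n^'n \<Rightarrow> real" where
  "gl_pairing A X = trace (A ** X)"

text \<open>A scalar product is given by its isomorphism \<open>S : T \<rightarrow> T\<^sup>*\<close>; its bilinear form is
  \<open>(v, w) \<mapsto> (S v)(w)\<close>.\<close>

definition scalar_products :: "(real^'n^'n) set" where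
  "scalar_products = {S. transpose S = S \<and> invertible S}"

definition ip :: "real^'n^'n \<Rightarrow> real^'n \<Rightarrow> real^'n \<Rightarrow> real" where
  "ip S v w = (S *v v) \<bullet> w"

definition lie_bracket :: "(real^'n \<Rightarrow> real^'n \<Rightarrow> real^'n) \<Rightarrow> bool" where
  "lie_bracket br \<longleftrightarrow> bilinear br \<and> (\<forall>v. br v v = 0)
     \<and> (\<forall>u v w. br u (br v w) + br v (br w u) + br w (br u v) = 0)"

definition killing_form :: "(real^'n \<Rightarrow> real^'n \<Rightarrow> real^'n) \<Rightarrow> real^'n \<Rightarrow> real^'n \<Rightarrow> real" where
  "killing_form br v w = trace (matrix (br v \<circ> br w))"

definition bracket_of :: "(real^'n \<Rightarrow> real^'n^'n) \<Rightarrow> real^'n \<Rightarrow> real^'n \<Rightarrow> real^'n" where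
  "bracket_of a v w = a v *v w"

definition killing_null_brackets :: "(real^'n \<Rightarrow> real^'n^'n) set" where
  "killing_null_brackets =
     {a \<in> V11_1. lie_bracket (bracket_of a) \<and> (\<forall>v w. killing_form (bracket_of a) v w = 0)}"

text \<open>
  Geometry of the left-invariant metric on a Lie group with Lie algebra \<open>(T, br)\<close>, expressed on
  left-invariant vector fields: \<open>D u v\<close> stands for \<open>\<nabla>\<^sub>u v\<close>. As \<open>ip S v w\<close> is constant for
  left-invariant \<open>v\<close> and \<open>w\<close>, metric compatibility says that \<open>\<nabla>\<^sub>u\<close> is skew for \<open>ip S\<close>.
\<close>

definition is_levi_civita ::
  "(real^'n \<Rightarrow> real^'n \<Rightarrow> real^'n) \<Rightarrow> real^'n^'n \<Rightarrow> (real^'n \<Rightarrow> real^'n \<Rightarrow> real^'n) \<Rightarrow> bool" where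
  "is_levi_civita br S D \<longleftrightarrow> bilinear D
     \<and> (\<forall>u v. D u v - D v u = br u v)
     \<and> (\<forall>u v w. ip S (D u v) w + ip S v (D u w) = 0)"

definition levi_civita ::
  "(real^'n \<Rightarrow> real^'n \<Rightarrow> real^'n) \<Rightarrow> real^'n^'n \<Rightarrow> real^'n \<Rightarrow> real^'n \<Rightarrow> real^'n" where
  "levi_civita br S = (THE D. is_levi_civita br S D)"

definition riemann_curvature ::
  "(real^'n \<Rightarrow> real^'n \<Rightarrow> real^'n) \<Rightarrow> real^'n^'n \<Rightarrow> real^'n \<Rightarrow> real^'n \<Rightarrow> real^'n \<Rightarrow> real^'n" where
  "riemann_curvature br S u v w =
     (let D = levi_civita br S in D u (D v w) - D v (D u w) - D (br u v) w)"

definition ricci_form ::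
  "(real^'n \<Rightarrow> real^'n \<Rightarrow> real^'n) \<Rightarrow> real^'n^'n \<Rightarrow> real^'n \<Rightarrow> real^'n \<Rightarrow> real" where
  "ricci_form br S v w = trace (matrix (\<lambda>u. riemann_curvature br S u v w))"

text \<open>The Ricci operator is \<open>S\<^sup>-\<^sup>1 \<circ> Ric\<close>, with the Ricci form regarded as a map \<open>T \<rightarrow> T\<^sup>*\<close>.\<close>

definition ric :: "(real^'n \<Rightarrow> real^'n^'n) \<Rightarrow> real^'n^'n \<Rightarrow> real^'n^'n" where
  "ric a S = matrix (\<lambda>v. matrix_inv S *v (\<chi> i. ricci_form (bracket_of a) S v (axis i 1)))"

definition scal :: "(real^'n \<Rightarrow> real^'n^'n) \<Rightarrow> real^'n^'n \<Rightarrow> real" where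
  "scal a S = trace (ric a S)"

text \<open>The element \<open>S\<^sup>-\<^sup>1e\<^sup>i \<otimes> S\<^sup>-\<^sup>1 \<^sup>ta\<^sub>i S\<close> of \<open>T \<otimes> End T\<close>, as a map \<open>T\<^sup>* \<rightarrow> End T\<close>.\<close>

definition q :: "(real^'n \<Rightarrow> real^'n^'n) \<Rightarrow> real^'n^'n \<Rightarrow> real^'n \<Rightarrow> real^'n^'n" where
  "q a S \<alpha> = (\<Sum>i\<in>UNIV. (\<alpha> \<bullet> (matrix_inv S *v axis i 1)) *\<^sub>R
                 (matrix_inv S ** transpose (a (axis i 1)) ** S))"

definition gl_act :: "real^'n^'n \<Rightarrow> (real^'n \<Rightarrow> real^'n^'n) \<Rightarrow> real^'n \<Rightarrow> real^'n^'n" where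
  "gl_act g a v = g ** a (matrix_inv g *v v) ** matrix_inv g"

text \<open>The matrix exponential; note that \<open>*\<close> and \<open>^\<close> on \<open>real^'n^'n\<close> are componentwise.\<close>

definition mexp :: "real^'n^'n \<Rightarrow> real^'n^'n" where
  "mexp X = (\<Sum>k. (1 / fact k) *\<^sub>R (((**) X ^^ k) (mat 1)))"

definition inf_act :: "real^'n^'n \<Rightarrow> (real^'n \<Rightarrow> real^'n^'n) \<Rightarrow> real^'n \<Rightarrow> real^'n^'n" where
  "inf_act X a v = vector_derivative (\<lambda>t. gl_act (mexp (t *\<^sub>R X)) a v) (at 0)"

definition fundamental_deriv ::
  "real^'n^'n \<Rightarrow> ((real^'n \<Rightarrow> real^'n^'n) \<Rightarrow> real^'n^'n \<Rightarrow> real) \<Rightarrow>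
     (real^'n \<Rightarrow> real^'n^'n) \<Rightarrow> real^'n^'n \<Rightarrow> real" where
  "fundamental_deriv X f a S = deriv (\<lambda>t. f (gl_act (mexp (t *\<^sub>R X)) a) S) 0"


lemma matrix_inv_mult:
  fixes S :: "real^'n^'n"
  assumes "invertible S"
  shows "S ** matrix_inv S = mat 1" "matrix_inv S ** S = mat 1"
  using someI_ex[OF assms[unfolded invertible_def]] by (auto simp: matrix_inv_def)

lemma ip_commute: "transpose S = S \<Longrightarrow> ip S v w = ip S w v"
  unfolding ip_def by (metis dot_lmul_matrix inner_commute transpose_matrix_vector)

lemma ip_nondegenerate:
  assumes "invertible S" "\<And>w. ip S v w = 0"
  shows "v = 0"
proof -
  have "S *v v = 0" using assms(2)[of "S *v v"] by (simp add: ip_def)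
  then have "matrix_inv S *v (S *v v) = 0" by simp
  then show ?thesis by (simp add: matrix_vector_mul_assoc matrix_inv_mult(2)[OF assms(1)])
qed

lemma ip_simps:
  "ip S (u + v) w = ip S u w + ip S v w" "ip S w (u + v) = ip S w u + ip S w v"
  "ip S (u - v) w = ip S u w - ip S v w" "ip S w (u - v) = ip S w u - ip S w v"
  "ip S (c *\<^sub>R v) w = c * ip S v w" "ip S w (c *\<^sub>R v) = c * ip S w v"
  "ip S (- v) w = - ip S v w" "ip S w (- v) = - ip S w v"
  using linear_add[OF matrix_vector_mul_linear[of S]] linear_diff[OF matrix_vector_mul_linear[of S]]
    linear_scale[OF matrix_vector_mul_linear[of S]] linear_neg[OF matrix_vector_mul_linear[of S]]
  by (simp_all add: ip_def inner_simps)

lemma levi_civita_unique: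
  fixes S :: "real^'n^'n"
  assumes S: "S \<in> scalar_products" and D: "is_levi_civita br S D" and E: "is_levi_civita br S E"
  shows "D = E"
proof (intro ext)
  fix u v
  have sym: "transpose S = S" and inv: "invertible S" using S by (auto simp: scalar_products_def)
  define F where "F u v = D u v - E u v" for u v
  have F_sym: "F u v = F v u" for u v
  proof -
    have "D u v - D v u = E u v - E v u" using D E by (simp add: is_levi_civita_def)
    then show ?thesis by (simp add: F_def algebra_simps)
  qed
  have skew: "ip S (F u v) w = - ip S v (F u w)" for u v w
  proof -
    have "ip S (D u v) w + ip S v (D u w) = 0" "ip S (E u v) w + ip S v (E u w) = 0"
      using D E by (auto simp: is_levi_civita_def)
    then show ?thesis by (simp add: F_def ip_simps)
  qed
  have "ip S (F u v) w = 0" for w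
  proof -
    have "ip S (F u v) w = - ip S (F w u) v"
      using skew[of u v w] by (simp add: ip_commute[OF sym, of v] F_sym[of w u])
    also have "\<dots> = ip S (F v w) u"
      using skew[of w u v] by (simp add: ip_commute[OF sym, of u] F_sym[of w v])
    also have "\<dots> = - ip S (F u v) w"
      using skew[of v w u] by (simp add: ip_commute[OF sym, of w] F_sym[of v u])
    finally show ?thesis by simp
  qed
  then show "D u v = E u v" using ip_nondegenerate[OF inv, of "F u v"] by (simp add: F_def)
qed

lemma levi_civita_exists:
  fixes S :: "real^'n^'n"
  assumes S: "S \<in> scalar_products" and br: "lie_bracket br"
  shows "\<exists>D. is_levi_civita br S D"
proof -
  have sym: "transpose S = S" and inv: "invertible S" using S by (auto simp: scalar_products_def)
  have bil: "bilinear br" and br0: "\<And>v. br v v = 0" using br by (auto simp: lie_bracket_def)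
  have skew: "br u v = - br v u" for u v
  proof -
    have "br (u + v) (u + v) = br u u + br u v + (br v u + br v v)"
      by (simp only: bilinear_ladd[OF bil] bilinear_radd[OF bil]) (simp add: algebra_simps)
    then have "br u v + br v u = 0" by (simp only: br0) simp
    then show ?thesis by (metis eq_neg_iff_add_eq_0)
  qed
  define k where "k u v w = (ip S (br u v) w - ip S (br v w) u + ip S (br w u) v) / 2" for u v w
  have k_simps: "k (u + u') v w = k u v w + k u' v w" "k u (v + v') w = k u v w + k u v' w"
    "k u v (w + w') = k u v w + k u v w'"
    "k (c *\<^sub>R u) v w = c * k u v w" "k u (c *\<^sub>R v) w = c * k u v w" "k u v (c *\<^sub>R w) = c * k u v w"
    for u u' v v' w w' c
    by (simp_all add: k_def bilinear_ladd[OF bil] bilinear_radd[OF bil] bilinear_lmul[OF bil]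
        bilinear_rmul[OF bil] ip_simps field_simps)
  have k_lin: "linear (k u v)" for u v by (rule linearI) (simp_all add: k_simps)
  define D where "D u v = matrix_inv S *v (\<chi> i. k u v (axis i 1))" for u v
  have koszul: "ip S (D u v) w = k u v w" for u v w
  proof -
    have "ip S (D u v) w = (\<Sum>i\<in>UNIV. k u v (axis i 1) * w $ i)"
      by (simp add: ip_def D_def matrix_vector_mul_assoc matrix_inv_mult(1)[OF inv] inner_vec_def)
    also have "\<dots> = k u v (\<Sum>i\<in>UNIV. w $ i *\<^sub>R axis i 1)"
      by (simp add: linear_sum[OF k_lin] k_simps mult.commute)
    also have "(\<Sum>i\<in>UNIV. w $ i *\<^sub>R axis i 1) = w"
      using basis_expansion[of w] by (simp add: scalar_mult_eq_scaleR)
    finally show ?thesis .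
  qed
  have eqI: "x = y" if "\<And>w. ip S x w = ip S y w" for x y
    using ip_nondegenerate[OF inv, of "x - y"] that by (simp add: ip_simps)
  have "bilinear D"
    unfolding bilinear_def by (intro conjI allI linearI eqI) (simp_all add: koszul ip_simps k_simps)
  moreover have "D u v - D v u = br u v" for u v
  proof (rule eqI)
    fix w
    show "ip S (D u v - D v u) w = ip S (br u v) w"
      using skew[of v u] skew[of u w] skew[of w v] by (simp add: ip_simps koszul k_def field_simps)
  qed
  moreover have "ip S (D u v) w + ip S v (D u w) = 0" for u v w
    using skew[of v u] skew[of u w] skew[of w v]
    by (simp add: ip_commute[OF sym, of v] koszul k_def ip_simps field_simps)
  ultimately show ?thesis unfolding is_levi_civita_def by blast
qed

lemma levi_civita_is_levi_civita:
  assumes "S \<in> scalar_products" "lie_bracket br"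
  shows "is_levi_civita br S (levi_civita br S)"
  unfolding levi_civita_def
  using levi_civita_exists[OF assms] levi_civita_unique[OF assms(1)] by (metis theI)

lemma q_in_V1_11:
  fixes a :: "real^'n \<Rightarrow> real^'n^'n"
  assumes a: "a \<in> V11_1" and S: "S \<in> scalar_products"
  shows "q a S \<in> V1_11"
proof -
  have sym: "transpose S = S" and inv: "invertible S" using S by (auto simp: scalar_products_def)
  have lin: "linear a" and skew: "\<And>v w. a v *v w = - (a w *v v)" and tr: "\<And>v. trace (a v) = 0"
    using a unfolding V11_1_def by blast+
  define T where "T = matrix_inv S"
  have ST: "S ** T = mat 1" and TS: "T ** S = mat 1" using matrix_inv_mult[OF inv] by (auto simp: T_def)
  have symT: "transpose T = T"
  proof -
    have "transpose T ** S = mat 1"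
      using arg_cong[OF ST, of transpose] by (simp add: matrix_transpose_mul sym)
    then have "transpose T ** (S ** T) = T" by (simp add: matrix_mul_assoc matrix_mul_lid)
    then show ?thesis by (simp add: ST matrix_mul_rid)
  qed
  have linM: "linear (\<lambda>M. T ** transpose M ** S)"
    by (rule linearI)
      (simp_all add: vec_eq_iff matrix_matrix_mult_def transpose_def algebra_simps sum.distrib
        sum_distrib_left sum_distrib_right)
  have q: "q a S \<alpha> = T ** transpose (a (T *v \<alpha>)) ** S" for \<alpha>
  proof -
    have c: "\<alpha> \<bullet> (T *v axis i 1) = (T *v \<alpha>) $ i" for i
      using dot_lmul_matrix[of \<alpha> T "axis i 1"] transpose_matrix_vector[of T \<alpha>]
      by (simp add: symT inner_axis)
    have "T *v \<alpha> = (\<Sum>i\<in>UNIV. (T *v \<alpha>) $ i *\<^sub>R axis i 1)"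
      using basis_expansion[of "T *v \<alpha>"] by (simp add: scalar_mult_eq_scaleR)
    then have "a (T *v \<alpha>) = (\<Sum>i\<in>UNIV. (T *v \<alpha>) $ i *\<^sub>R a (axis i 1))"
      using linear_sum[OF lin, of "\<lambda>i. (T *v \<alpha>) $ i *\<^sub>R axis i 1" UNIV] by (simp add: linear_scale[OF lin])
    then show ?thesis
      by (simp add: q_def T_def[symmetric] c linear_sum[OF linM] linear_scale[OF linM])
  qed
  have "linear (q a S)"
    by (rule linearI)
      (simp_all add: q linear_add[OF linM] linear_scale[OF linM] linear_add[OF lin] linear_scale[OF lin]
       matrix_vector_right_distrib matrix_vector_mult_scaleR)
  moreover have "transpose (q a S \<alpha>) *v \<beta> = - (transpose (q a S \<beta>) *v \<alpha>)" for \<alpha> \<beta>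
  proof -
    have "transpose (q a S \<alpha>) *v \<beta> = S *v (a (T *v \<alpha>) *v (T *v \<beta>))" for \<alpha> \<beta>
      by (simp add: q matrix_transpose_mul sym symT matrix_vector_mul_assoc matrix_mul_assoc)
    then show ?thesis
      using skew[of "T *v \<alpha>" "T *v \<beta>"] linear_neg[OF matrix_vector_mul_linear[of S]] by simp
  qed
  moreover have "trace (q a S \<alpha>) = 0" for \<alpha>
  proof -
    have "trace (q a S \<alpha>) = trace (S ** (T ** transpose (a (T *v \<alpha>))))"
      unfolding q by (rule trace_mul_sym)
    also have "\<dots> = trace (a (T *v \<alpha>))"
      by (simp add: matrix_mul_assoc ST) (simp add: trace_def transpose_def)
    finally show ?thesis by (simp add: tr)
  qed
  ultimately show ?thesis unfolding V1_11_def by blast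
qed

lemma bilinear_matrix_mult: "bounded_bilinear ((**) :: real^'n^'n \<Rightarrow> real^'n^'n \<Rightarrow> real^'n^'n)"
  by (rule bilinear_conv_bounded_bilinear[THEN iffD1])
    (auto simp: bilinear_def vec_eq_iff matrix_matrix_mult_def algebra_simps sum.distrib
      sum_distrib_left sum_distrib_right intro!: linearI)

lemma mat_pow_entry_bound:
  "\<bar>(((**) X ^^ k) (mat 1)) $ i $ j\<bar> \<le> (\<Sum>i\<in>UNIV. \<Sum>j\<in>UNIV. \<bar>X $ i $ j\<bar>) ^ k" for X :: "real^'n^'n"
proof (induction k arbitrary: i j)
  case 0 then show ?case by (simp add: mat_def)
next
  case (Suc k)
  define c where "c = (\<Sum>i\<in>UNIV. \<Sum>j\<in>UNIV. \<bar>X $ i $ j\<bar>)"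
  define P where "P = ((**) X ^^ k) (mat 1)"
  have c0: "c \<ge> 0" by (simp add: c_def sum_nonneg)
  have "\<bar>\<Sum>l\<in>UNIV. X $ i $ l * P $ l $ j\<bar> \<le> (\<Sum>l\<in>UNIV. \<bar>X $ i $ l\<bar> * c ^ k)"
    by (rule order_trans[OF sum_abs]) (auto intro!: sum_mono mult_left_mono simp: abs_mult P_def c_def Suc.IH)
  also have "\<dots> = (\<Sum>l\<in>UNIV. \<bar>X $ i $ l\<bar>) * c ^ k" by (simp add: sum_distrib_right)
  also have "\<dots> \<le> c * c ^ k"
    unfolding c_def using c0
    by (intro mult_right_mono member_le_sum[where f="\<lambda>i. \<Sum>j\<in>UNIV. \<bar>X $ i $ j\<bar>"])
      (auto simp: sum_nonneg c_def)
  finally have "\<bar>(X ** P) $ i $ j\<bar> \<le> c ^ Suc k" by (simp add: matrix_matrix_mult_def)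
  then show ?case by (simp add: P_def c_def)
qed

lemma mat_pow_scaleR: "(((**) (t *\<^sub>R X)) ^^ k) (mat 1) = t ^ k *\<^sub>R (((**) X ^^ k) (mat 1))"
  for X :: "real^'n^'n"
  by (induction k) (simp_all add: bounded_bilinear.scaleR_left[OF bilinear_matrix_mult]
      bounded_bilinear.scaleR_right[OF bilinear_matrix_mult])

lemma mexp_entry_summable:
  "summable (\<lambda>k. (((**) X ^^ k) (mat 1)) $ i $ j / fact k * t ^ k)" for X :: "real^'n^'n" and t :: real
proof (rule summable_comparison_test')
  define c where "c = (\<Sum>i\<in>UNIV. \<Sum>j\<in>UNIV. \<bar>X $ i $ j\<bar>)"
  show "summable (\<lambda>k. (c * \<bar>t\<bar>) ^ k / fact k)"
    using summable_exp[of "c * \<bar>t\<bar>"] by (simp add: field_simps)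
  show "norm ((((**) X ^^ k) (mat 1)) $ i $ j / fact k * t ^ k) \<le> (c * \<bar>t\<bar>) ^ k / fact k" for k
    using mult_right_mono[OF mat_pow_entry_bound[of k X i j], of "\<bar>t\<bar> ^ k / fact k"]
    by (simp add: c_def abs_mult power_mult_distrib power_abs)
qed

lemma mexp_scaleR_entry:
  "mexp (t *\<^sub>R X) $ i $ j = (\<Sum>k. (((**) X ^^ k) (mat 1)) $ i $ j / fact k * t ^ k)" for X :: "real^'n^'n"
proof -
  let ?f = "\<lambda>k. (1 / fact k) *\<^sub>R (((**) (t *\<^sub>R X) ^^ k) (mat 1))"
  have *: "?f k $ i $ j = (((**) X ^^ k) (mat 1)) $ i $ j / fact k * t ^ k" for i j k
    by (simp add: mat_pow_scaleR)
  have "?f sums (\<chi> i j. \<Sum>k. (((**) X ^^ k) (mat 1)) $ i $ j / fact k * t ^ k)"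
    unfolding sums_def
  proof (intro vec_tendstoI, unfold sum_component vec_lambda_beta * sums_def[symmetric])
    show "(\<lambda>k. (((**) X ^^ k) (mat 1)) $ i $ j / fact k * t ^ k) sums
      (\<Sum>k. (((**) X ^^ k) (mat 1)) $ i $ j / fact k * t ^ k)" for i j
      by (rule summable_sums[OF mexp_entry_summable])
  qed
  then show ?thesis unfolding mexp_def by (simp add: sums_iff)
qed

lemma has_vector_derivative_at_iff_tendsto:
  "(f has_vector_derivative d) (at x) \<longleftrightarrow> ((\<lambda>t. (f t - f x) /\<^sub>R (t - x)) \<longlongrightarrow> d) (at x)"
proof -
  have "norm (((f t - f x) /\<^sub>R (t - x)) - d) = norm (f t - f x - (t - x) *\<^sub>R d) / norm (t - x)"
    if "t \<noteq> x" for t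
  proof -
    have "((f t - f x) /\<^sub>R (t - x)) - d = (f t - f x - (t - x) *\<^sub>R d) /\<^sub>R (t - x)"
      using that by (simp add: scaleR_diff_right)
    then show ?thesis by (simp add: divide_inverse mult.commute)
  qed
  then have "((\<lambda>t. norm (((f t - f x) /\<^sub>R (t - x)) - d)) \<longlongrightarrow> 0) (at x) \<longleftrightarrow>
      ((\<lambda>t. norm (f t - f x - (t - x) *\<^sub>R d) / norm (t - x)) \<longlongrightarrow> 0) (at x)"
    by (intro filterlim_cong) (auto simp: eventually_at_filter)
  moreover have "((\<lambda>t. (f t - f x) /\<^sub>R (t - x)) \<longlongrightarrow> d) (at x) \<longleftrightarrow>
      ((\<lambda>t. norm (((f t - f x) /\<^sub>R (t - x)) - d)) \<longlongrightarrow> 0) (at x)"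
    by (rule trans[OF LIM_zero_iff[symmetric] tendsto_norm_zero_iff[symmetric]])
  ultimately show ?thesis
    unfolding has_vector_derivative_def has_derivative_iff_norm
    by (simp only: bounded_linear_scaleR_left simp_thms)
qed

lemma mexp_has_vector_derivative:
  "((\<lambda>t. mexp (t *\<^sub>R X)) has_vector_derivative X) (at 0)" for X :: "real^'n^'n"
proof -
  have "((\<lambda>t. mexp (t *\<^sub>R X) $ i $ j) has_real_derivative X $ i $ j) (at 0)" for i j
  proof -
    let ?c = "\<lambda>k. (((**) X ^^ k) (mat 1)) $ i $ j / fact k"
    have "((\<lambda>t. \<Sum>k. ?c k * t ^ k) has_real_derivative (\<Sum>k. diffs ?c k * 0 ^ k)) (at 0)"
      by (rule termdiffs_strong_converges_everywhere) (rule mexp_entry_summable)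
    moreover have "(\<Sum>k. diffs ?c k * 0 ^ k) = X $ i $ j"
      by (subst powser_zero) (simp add: diffs_def)
    ultimately show ?thesis by (simp add: mexp_scaleR_entry)
  qed
  then have "((\<lambda>t. (mexp (t *\<^sub>R X) $ i $ j - mexp (0 *\<^sub>R X) $ i $ j) / (t - 0)) \<longlongrightarrow> X $ i $ j) (at 0)" for i j
    by (simp add: has_field_derivative_iff)
  then show ?thesis
    unfolding has_vector_derivative_at_iff_tendsto
    by (intro vec_tendstoI) (simp add: divide_inverse mult.commute)
qed

lemma mexp_0: "mexp (0 :: real^'n^'n) = mat 1"
proof -
  have "mexp (0 *\<^sub>R (0 :: real^'n^'n)) $ i $ j = mat 1 $ i $ j" for i j
    by (subst mexp_scaleR_entry, subst powser_zero) simp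
  then show ?thesis by (simp add: vec_eq_iff)
qed

lemma mexp_tendsto: "((\<lambda>t. mexp (t *\<^sub>R X)) \<longlongrightarrow> mat 1) (at 0)" for X :: "real^'n^'n"
  using has_vector_derivative_continuous[OF mexp_has_vector_derivative[of X]]
  by (simp add: continuous_at mexp_0 isCont_def)

lemma mexp_inverse_has_vector_derivative:
  "((\<lambda>t. matrix_inv (mexp (t *\<^sub>R X))) has_vector_derivative - X) (at 0)" for X :: "real^'n^'n"
proof -
  interpret M: bounded_bilinear "(**) :: real^'n^'n \<Rightarrow> real^'n^'n \<Rightarrow> real^'n^'n"
    by (rule bilinear_matrix_mult)
  define g where "g t = mexp (t *\<^sub>R X)" for t
  define h where "h t = matrix_inv (g t)" for t
  have g0: "g 0 = mat 1" by (simp add: g_def mexp_0)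
  have glim: "(g \<longlongrightarrow> mat 1) (at 0)" using mexp_tendsto[of X] by (simp add: g_def[abs_def])
  have "((\<lambda>t. det (g t)) \<longlongrightarrow> det (mat 1 :: real^'n^'n)) (at 0)"
    unfolding det_def by (intro tendsto_intros tendsto_vec_nth glim)
  then have "\<forall>\<^sub>F t in at 0. det (g t) \<noteq> 0"
    by (rule tendsto_imp_eventually_ne) simp
  then have inv: "\<forall>\<^sub>F t in at 0. h t ** g t = mat 1"
    by eventually_elim (simp add: h_def invertible_det_nz matrix_inv_mult)
  obtain K where K: "K > 0" "\<And>(A :: real^'n^'n) (B :: real^'n^'n). norm (A ** B) \<le> norm A * norm B * K"
    using M.pos_bounded by blast
  have "((\<lambda>t. norm (g t - mat 1)) \<longlongrightarrow> 0) (at 0)" by (intro tendsto_norm_zero LIM_zero glim)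
  then have "\<forall>\<^sub>F t in at 0. norm (g t - mat 1) < 1 / (2 * K)"
    by (rule order_tendstoD) (simp add: K)
  then have bd: "\<forall>\<^sub>F t in at 0. norm (h t) \<le> 2 * norm (mat 1 :: real^'n^'n)"
    using inv
  proof eventually_elim
    case (elim t)
    have "h t = mat 1 - h t ** (g t - mat 1)" using elim(2) by (simp add: M.diff_right matrix_mul_rid)
    then have "norm (h t) \<le> norm (mat 1 :: real^'n^'n) + norm (h t ** (g t - mat 1))"
      by (metis norm_triangle_ineq4)
    also have "norm (h t ** (g t - mat 1)) \<le> norm (h t) * (norm (g t - mat 1) * K)"
      using K(2) by (simp add: mult.assoc)
    also have "\<dots> \<le> norm (h t) * (1 / 2)"
      using elim(1) K(1) by (intro mult_left_mono) (auto simp: field_simps)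
    finally show ?case by simp
  qed
  have "((\<lambda>t. h t ** (g t - mat 1)) \<longlongrightarrow> 0) (at 0)"
  proof -
    have "Zfun (\<lambda>t. g t - mat 1) (at 0)" using glim by (simp only: tendsto_Zfun_iff)
    then have "Zfun (\<lambda>t. h t ** (g t - mat 1)) (at 0)" by (rule M.Bfun_prod_Zfun[OF BfunI[OF bd]])
    then show ?thesis by (simp add: tendsto_Zfun_iff)
  qed
  then have "((\<lambda>t. mat 1 - h t ** (g t - mat 1)) \<longlongrightarrow> mat 1 - 0) (at 0)"
    by (intro tendsto_intros)
  moreover have "\<forall>\<^sub>F t in at 0. mat 1 - h t ** (g t - mat 1) = h t"
    using inv by eventually_elim (simp add: M.diff_right matrix_mul_rid)
  ultimately have hlim: "(h \<longlongrightarrow> mat 1) (at 0)"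
    by (simp add: tendsto_cong)
  have "((\<lambda>t. (g t - g 0) /\<^sub>R (t - 0)) \<longlongrightarrow> X) (at 0)"
    using mexp_has_vector_derivative[of X] unfolding has_vector_derivative_at_iff_tendsto g_def .
  then have "((\<lambda>t. - (h t ** ((g t - g 0) /\<^sub>R (t - 0)))) \<longlongrightarrow> - (mat 1 ** X)) (at 0)"
    by (intro tendsto_intros M.tendsto hlim)
  moreover have "\<forall>\<^sub>F t in at 0. - (h t ** ((g t - g 0) /\<^sub>R (t - 0))) = (h t - h 0) /\<^sub>R (t - 0)"
    using inv
  proof eventually_elim
    case (elim t)
    have "h 0 = mat 1" using matrix_inv_mult(1)[of "mat 1 :: real^'n^'n"] by (simp add: h_def g0 invertible_def exI[of _ "mat 1"])
    then show ?case using elim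
      by (simp add: g0 M.scaleR_right M.diff_right matrix_mul_rid scaleR_right_diff_distrib)
  qed
  ultimately have "((\<lambda>t. (h t - h 0) /\<^sub>R (t - 0)) \<longlongrightarrow> - X) (at 0)"
    by (auto intro: Lim_transform_eventually)
  then show ?thesis unfolding has_vector_derivative_at_iff_tendsto h_def g_def .
qed

lemma inf_act_formula:
  fixes a :: "real^'n \<Rightarrow> real^'n^'n"
  assumes "linear a"
  shows "((\<lambda>t. gl_act (mexp (t *\<^sub>R X)) a v) has_vector_derivative
            (X ** a v - a v ** X - a (X *v v))) (at 0)" (is ?A)
    and "inf_act X a v = X ** a v - a v ** X - a (X *v v)"
proof -
  interpret M: bounded_bilinear "(**) :: real^'n^'n \<Rightarrow> real^'n^'n \<Rightarrow> real^'n^'n"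
    by (rule bilinear_matrix_mult)
  have inv1: "matrix_inv (mat 1) = (mat 1 :: real^'n^'n)"
    using matrix_inv_mult(1)[of "mat 1 :: real^'n^'n"] by (simp add: invertible_def exI[of _ "mat 1"])
  have "linear (\<lambda>A. a (A *v v))"
    by (rule linearI) (simp_all add: matrix_vector_mult_add_rdistrib scaleR_matrix_vector_assoc[symmetric]
        linear_add[OF assms] linear_scale[OF assms])
  then have "bounded_linear (\<lambda>A. a (A *v v))" by (simp add: linear_conv_bounded_linear)
  note d = bounded_linear.has_vector_derivative[OF this mexp_inverse_has_vector_derivative[of X]]
  have minus: "(- X) *v v = - (X *v v)"
    using scaleR_matrix_vector_assoc[of "-1" X v] by simp
  show ?A
    unfolding gl_act_def
    using M.has_vector_derivative[OF M.has_vector_derivative[OF mexp_has_vector_derivative[of X] d]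
        mexp_inverse_has_vector_derivative[of X]]
    by (simp add: mexp_0 inv1 matrix_mul_lid matrix_mul_rid M.minus_right linear_neg[OF assms]
        minus algebra_simps)
  then show "inf_act X a v = X ** a v - a v ** X - a (X *v v)"
    unfolding inf_act_def by (rule vector_derivative_at)
qed

end

theory Submission
  imports Defs
begin

text \<open>
  For a unimodular Lie algebra with zero Killing form the Ricci form is
  \<open>- 1/2 tr (ad v (ad w)\<^sup>*) - 1/4 tr (J v J w)\<close>, where \<open>J w\<close> is the skew endomorphism
  \<open>u \<mapsto> (ad u)\<^sup>* w\<close>. Contracting with \<open>X\<close> and using \<open>a(v)w = - a(w)v\<close> to move indices, the two terms
  become those of \<open>\<langle>Xa, q(a, S)\<rangle>\<close>. The choice \<open>X = id\<close>, for which \<open>Xa = - a\<close>, gives the scalar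
  curvature as \<open>- 1/4 \<langle>a, q(a, S)\<rangle>\<close>. This is a symmetric quadratic expression in \<open>a\<close>, so its derivative
  along \<open>X\<close> is \<open>- 1/2 \<langle>Xa, q(a, S)\<rangle>\<close>.
\<close>

section \<open>Matrix algebra: inverses, traces and transposes\<close>

lemma scalar_product_inverse:
  fixes S :: "real^'n^'n"
  assumes "S \<in> scalar_products"
  shows "S ** matrix_inv S = mat 1" "matrix_inv S ** S = mat 1"
    "transpose S = S" "transpose (matrix_inv S) = matrix_inv S"
proof -
  have sym: "transpose S = S" and inv: "invertible S"
    using assms by (auto simp: scalar_products_def)
  note ST = matrix_inv_mult[OF inv]
  show "S ** matrix_inv S = mat 1" "matrix_inv S ** S = mat 1" "transpose S = S"
    by (fact ST sym)+
  have "transpose (matrix_inv S) ** S = mat 1"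
    using arg_cong[OF ST(1), of transpose] by (simp add: matrix_transpose_mul sym)
  then have "transpose (matrix_inv S) ** (S ** matrix_inv S) = matrix_inv S"
    by (simp add: matrix_mul_assoc)
  then show "transpose (matrix_inv S) = matrix_inv S"
    by (simp add: ST)
qed

lemma trace_transpose: "trace (transpose A) = trace A"
  by (simp add: trace_def transpose_def)

lemma trace_scaleR: "trace (c *\<^sub>R A) = c * trace (A :: real^'n^'n)"
  by (simp add: trace_def sum_distrib_left)

lemma trace_uminus: "trace (- A) = - trace (A :: real^'n^'n)"
  by (simp add: trace_def sum_negf)

lemma inner_matrix_vector_left: "(A *v x) \<bullet> y = x \<bullet> (transpose A *v y)" for A :: "real^'n^'n"
  by (metis dot_lmul_matrix transpose_matrix_vector transpose_transpose)

lemma trace_eq_sum_inner: "trace A = (\<Sum>i\<in>UNIV. (A *v axis i 1) \<bullet> axis i 1)" for A :: "real^'n^'n"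
  by (simp add: trace_def inner_axis matrix_vector_mul_component column_def matrix_vector_mult_basis)

text \<open>Expanding the images of basis vectors in coordinates makes both sides the double sum of
  \<open>P $ k $ i * B (axis k 1) (axis i 1)\<close>. It serves to move \<open>matrix_inv S\<close>
  from one slot to the other when the scalar curvature is differentiated.\<close>

lemma sum_bilinear_transfer:
  fixes B :: "real^'n \<Rightarrow> real^'n \<Rightarrow> real" and P :: "real^'n^'n"
  assumes "bilinear B"
  shows "(\<Sum>i\<in>UNIV. B (P *v axis i 1) (axis i 1)) = (\<Sum>i\<in>UNIV. B (axis i 1) (transpose P *v axis i 1))"
proof -
  have l: "linear (\<lambda>x. B x y)" and r: "linear (B x)" for x y
    using assms by (auto simp: bilinear_def)
  have ex: "v = (\<Sum>k\<in>UNIV. v $ k *\<^sub>R axis k 1)" for v :: "real^'n"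
    using basis_expansion[of v] by (simp add: scalar_mult_eq_scaleR)
  have "B (P *v axis i 1) (axis i 1) = (\<Sum>k\<in>UNIV. P $ k $ i * B (axis k 1) (axis i 1))" for i
    by (subst ex[of "P *v axis i 1"])
      (simp add: linear_sum[OF l] linear_scale[OF l] matrix_vector_mult_basis column_def)
  moreover have "B (axis i 1) (transpose P *v axis i 1) = (\<Sum>k\<in>UNIV. P $ i $ k * B (axis i 1) (axis k 1))" for i
    by (subst ex[of "transpose P *v axis i 1"])
      (simp add: linear_sum[OF r] linear_scale[OF r] matrix_vector_mult_basis column_def transpose_def)
  ultimately show ?thesis
    using sum.swap[of "\<lambda>i k. P $ k $ i * B (axis k 1) (axis i 1)" UNIV UNIV] by simp
qed

lemma matrix_mult_simps:
  fixes A B C :: "real^'n^'n"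
  shows "(A + B) ** C = A ** C + B ** C" "A ** (B + C) = A ** B + A ** C"
    "(A - B) ** C = A ** C - B ** C" "A ** (B - C) = A ** B - A ** C"
    "(- A) ** B = - (A ** B)" "A ** (- B) = - (A ** B)"
    "(c *\<^sub>R A) ** B = c *\<^sub>R (A ** B)" "A ** (c *\<^sub>R B) = c *\<^sub>R (A ** B)"
proof -
  interpret M: bounded_bilinear "(**) :: real^'n^'n \<Rightarrow> real^'n^'n \<Rightarrow> real^'n^'n"
    by (rule bilinear_matrix_mult)
  show "(A + B) ** C = A ** C + B ** C" "A ** (B + C) = A ** B + A ** C"
    "(A - B) ** C = A ** C - B ** C" "A ** (B - C) = A ** B - A ** C"
    "(- A) ** B = - (A ** B)" "A ** (- B) = - (A ** B)"
    "(c *\<^sub>R A) ** B = c *\<^sub>R (A ** B)" "A ** (c *\<^sub>R B) = c *\<^sub>R (A ** B)"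
    by (fact M.add_left M.add_right M.diff_left M.diff_right M.minus_left M.minus_right
        M.scaleR_left M.scaleR_right)+
qed

lemma matrix_vector_simps:
  fixes A B :: "real^'n^'n"
  shows "(A + B) *v x = A *v x + B *v x" "(A - B) *v x = A *v x - B *v x"
    "(- A) *v x = - (A *v x)" "(c *\<^sub>R A) *v x = c *\<^sub>R (A *v x)"
    "A *v (x + y) = A *v x + A *v y" "A *v (x - y) = A *v x - A *v y"
    "A *v (- x) = - (A *v x)" "A *v (c *\<^sub>R x) = c *\<^sub>R (A *v x)"
  using scaleR_matrix_vector_assoc[of "-1" A x] linear_neg[OF matrix_vector_mul_linear[of A], of x]
  by (simp_all add: matrix_vector_mult_add_rdistrib matrix_vector_mult_diff_rdistrib
      scaleR_matrix_vector_assoc[symmetric] matrix_vector_right_distrib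
      matrix_vector_mult_diff_distrib matrix_vector_mult_scaleR)

lemma transpose_simps:
  fixes A B :: "real^'n^'n"
  shows "transpose (A + B) = transpose A + transpose B"
    "transpose (- A) = - transpose A" "transpose (c *\<^sub>R A) = c *\<^sub>R transpose A"
  by (simp_all add: vec_eq_iff transpose_def)

section \<open>Adjoints with respect to the scalar product\<close>

text \<open>For a scalar product \<open>S\<close> this is the adjoint of \<open>M\<close> for
  \<open>ip S\<close>; the same expression is the endomorphism factor in \<open>q\<close>, which
  links the Levi-Civita connection to \<open>q\<close>.\<close>

definition metric_adjoint :: "real^'n^'n \<Rightarrow> real^'n^'n \<Rightarrow> real^'n^'n" where
  "metric_adjoint S M = matrix_inv S ** transpose M ** S"

lemma metric_adjoint_simps:
  "metric_adjoint S (A + B) = metric_adjoint S A + metric_adjoint S B"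
  "metric_adjoint S (c *\<^sub>R A) = c *\<^sub>R metric_adjoint S A"
  "metric_adjoint S (- A) = - metric_adjoint S A"
  by (simp_all add: metric_adjoint_def transpose_simps matrix_mult_simps)

lemma trace_metric_adjoint:
  assumes "S \<in> scalar_products"
  shows "trace (metric_adjoint S A) = trace A"
proof -
  have "trace (metric_adjoint S A) = trace (S ** (matrix_inv S ** transpose A))"
    unfolding metric_adjoint_def by (rule trace_mul_sym)
  then show ?thesis by (simp add: matrix_mul_assoc scalar_product_inverse[OF assms] trace_transpose)
qed

lemma metric_adjoint_mult:
  assumes "S \<in> scalar_products"
  shows "metric_adjoint S (A ** B) = metric_adjoint S B ** metric_adjoint S A"
proof -
  note S = scalar_product_inverse[OF assms]
  have "metric_adjoint S B ** metric_adjoint S A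
      = matrix_inv S ** transpose B ** (S ** matrix_inv S) ** transpose A ** S"
    unfolding metric_adjoint_def by (simp only: matrix_mul_assoc)
  then show ?thesis by (simp add: S metric_adjoint_def matrix_transpose_mul matrix_mul_assoc)
qed

lemma metric_adjoint_involutive:
  assumes "S \<in> scalar_products"
  shows "metric_adjoint S (metric_adjoint S A) = A"
proof -
  note S = scalar_product_inverse[OF assms]
  have "metric_adjoint S (metric_adjoint S A) = (matrix_inv S ** S) ** A ** (matrix_inv S ** S)"
    unfolding metric_adjoint_def by (simp only: matrix_transpose_mul transpose_transpose S(3,4) matrix_mul_assoc)
  then show ?thesis by (simp add: S)
qed

lemma ip_metric_adjoint:
  assumes "S \<in> scalar_products"
  shows "ip S (metric_adjoint S A *v v) w = ip S v (A *v w)"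
proof -
  note S = scalar_product_inverse[OF assms]
  have "S *v (metric_adjoint S A *v v) = transpose A *v (S *v v)"
    by (simp only: metric_adjoint_def matrix_vector_mul_assoc matrix_mul_assoc S matrix_mul_lid)
  then show ?thesis
    by (simp only: ip_def inner_matrix_vector_left transpose_transpose)
qed

section \<open>The Levi-Civita connection and the Ricci form\<close>

lemma V11_1_D:
  assumes "a \<in> V11_1"
  shows "linear a" "a v *v w = - (a w *v v)" "trace (a v) = 0"
  using assms unfolding V11_1_def by blast+

text \<open>The third term of the Koszul formula, written \<open>J w\<close> above.\<close>

definition metric_ad_swap :: "(real^'n \<Rightarrow> real^'n^'n) \<Rightarrow> real^'n^'n \<Rightarrow> real^'n \<Rightarrow> real^'n^'n" where
  "metric_ad_swap a S w = matrix (\<lambda>u. metric_adjoint S (a u) *v w)"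

lemma metric_ad_swap_apply:
  assumes "linear a"
  shows "metric_ad_swap a S w *v u = metric_adjoint S (a u) *v w"
proof -
  have "linear (\<lambda>u. metric_adjoint S (a u) *v w)"
    by (rule linearI) (simp_all add: linear_add[OF assms] linear_scale[OF assms]
        metric_adjoint_simps matrix_vector_simps)
  then show ?thesis by (simp add: metric_ad_swap_def)
qed

lemma matrix_eqI_ip:
  fixes A B :: "real^'n^'n"
  assumes "S \<in> scalar_products" "\<And>v w. ip S (A *v v) w = ip S (B *v v) w"
  shows "A = B"
proof -
  have "A *v v - B *v v = 0" for v
    using assms by (intro ip_nondegenerate[of S]) (auto simp: ip_simps scalar_products_def)
  then show ?thesis by (simp add: matrix_eq)
qed

text \<open>Pairing \<open>J w *v u\<close> with \<open>v\<close> gives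
  \<open>ip S w (a u *v v)\<close>, which changes sign when \<open>u\<close> and \<open>v\<close>
  are exchanged.\<close>

lemma metric_adjoint_ad_swap:
  assumes "a \<in> V11_1" "S \<in> scalar_products"
  shows "metric_adjoint S (metric_ad_swap a S w) = - metric_ad_swap a S w"
proof (rule matrix_eqI_ip[OF assms(2)])
  fix u v
  note a = V11_1_D[OF assms(1)]
  have c: "ip S x y = ip S y x" for x y by (rule ip_commute) (rule scalar_product_inverse[OF assms(2)])
  have "ip S (metric_adjoint S (metric_ad_swap a S w) *v u) v = ip S (metric_ad_swap a S w *v v) u"
    by (simp add: ip_metric_adjoint[OF assms(2)] c[of u])
  also have "\<dots> = ip S w (a v *v u)"
    by (simp add: metric_ad_swap_apply[OF a(1)] ip_metric_adjoint[OF assms(2)])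
  also have "\<dots> = - ip S w (a u *v v)" by (subst a(2)) (simp add: ip_simps)
  also have "\<dots> = ip S (- metric_ad_swap a S w *v u) v"
    by (simp add: metric_ad_swap_apply[OF a(1)] ip_metric_adjoint[OF assms(2)] ip_simps matrix_vector_simps)
  finally show "ip S (metric_adjoint S (metric_ad_swap a S w) *v u) v = ip S (- metric_ad_swap a S w *v u) v" .
qed

text \<open>This is the Koszul formula solved with adjoints. By uniqueness it suffices that the
  candidate is bilinear, torsion-free and metric.\<close>

lemma levi_civita_bracket_of:
  assumes "a \<in> V11_1" "S \<in> scalar_products"
  shows "levi_civita (bracket_of a) S
    = (\<lambda>u v. (1/2) *\<^sub>R (a u *v v - metric_adjoint S (a u) *v v - metric_adjoint S (a v) *v u))"
    (is "_ = ?D")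
proof -
  note a = V11_1_D[OF assms(1)]
  note lin = linear_add[OF a(1)] linear_scale[OF a(1)]
  have c: "ip S x y = ip S y x" for x y by (rule ip_commute) (rule scalar_product_inverse[OF assms(2)])
  have "bilinear ?D"
    unfolding bilinear_def
    by (intro conjI allI linearI)
      (simp_all add: lin metric_adjoint_simps matrix_vector_simps algebra_simps)
  moreover have "?D u v - ?D v u = bracket_of a u v" for u v
  proof -
    \<comment> \<open>The two adjoint terms of \<open>?D\<close> together are symmetric in
      \<open>u\<close> and \<open>v\<close>, so they cancel.\<close>
    have "?D u v - ?D v u = (1/2) *\<^sub>R (a u *v v) - (1/2) *\<^sub>R (a v *v u)"
      by (simp add: algebra_simps)
    also have "\<dots> = (1/2 + 1/2) *\<^sub>R (a u *v v)"
      by (subst (2) a(2)) (simp only: scaleR_add_left scaleR_minus_right diff_minus_eq_add)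
    finally show ?thesis by (simp add: bracket_of_def)
  qed
  moreover have "ip S (?D u v) w + ip S v (?D u w) = 0" for u v w
  proof -
    have 1: "ip S v (metric_adjoint S A *v x) = ip S (A *v v) x" for v x A
      using ip_metric_adjoint[OF assms(2), of A x v] by (simp add: c)
    \<comment> \<open>Moving adjoints across \<open>ip S\<close> cancels the terms containing
      \<open>a u\<close>; the two that remain cancel by this antisymmetry.\<close>
    have "ip S u (a v *v w) = - ip S u (a w *v v)" by (subst a(2)) (simp add: ip_simps)
    then show ?thesis
      by (simp add: ip_simps ip_metric_adjoint[OF assms(2)] 1 c[of "a w *v v"] field_simps)
  qed
  ultimately have "is_levi_civita (bracket_of a) S ?D" unfolding is_levi_civita_def by blast
  then show ?thesis
    unfolding levi_civita_def using levi_civita_unique[OF assms(2)] by (intro the_equality) auto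
qed

text \<open>Writing \<open>L w\<close> for \<open>u \<mapsto> D u w\<close>, torsion-freeness gives \<open>D w = L w + a w\<close>. As \<open>L\<close> is trace-free,
  the Ricci form is \<open>- tr (L v L w)\<close>, and \<open>L w\<close> splits into a self-adjoint and a skew part.\<close>

lemma ricci_form_killing_null:
  fixes a :: "real^'n \<Rightarrow> real^'n^'n"
  assumes aV: "a \<in> V11_1" and S: "S \<in> scalar_products"
    and kill: "\<And>v w. killing_form (bracket_of a) v w = 0"
  shows "ricci_form (bracket_of a) S v w =
    - (1/2) * trace (a v ** metric_adjoint S (a w))
    - (1/4) * trace (metric_ad_swap a S v ** metric_ad_swap a S w)"
proof -
  note a = V11_1_D[OF aV]
  let ?t = "metric_adjoint S" and ?J = "metric_ad_swap a S"
  define D where "D = levi_civita (bracket_of a) S"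
  \<comment> \<open>Each term of \<open>D u w\<close> is read as a function of \<open>u\<close>:
    \<open>a u *v w\<close> is \<open>- (a w *v u)\<close>, and \<open>?t (a u) *v w\<close> is
    \<open>?J w *v u\<close>.\<close>
  define L where "L w = (-1/2) *\<^sub>R (a w + ?t (a w) + ?J w)" for w
  have DL: "D u w = L w *v u" for u w
    unfolding D_def levi_civita_bracket_of[OF aV S]
    by (simp add: L_def matrix_vector_simps metric_ad_swap_apply[OF a(1)] a(2)[of u w] algebra_simps)
  have half: "(1/2) *\<^sub>R (x - y - z) = (-1/2) *\<^sub>R (x + y + z) + x" for x y z :: "real^'n"
    by (simp add: vec_eq_iff field_simps)
  have DR: "D w u = (L w + a w) *v u" for u w
    unfolding D_def levi_civita_bracket_of[OF aV S]
    by (simp add: L_def matrix_vector_simps metric_ad_swap_apply[OF a(1)] half[of "a w *v u"])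
  \<comment> \<open>An endomorphism has the same trace as its adjoint, so a skew one is
    trace-free.\<close>
  have trJ: "trace (?J w) = 0" for w
    using trace_metric_adjoint[OF S, of "?J w"] by (simp add: metric_adjoint_ad_swap[OF aV S] trace_uminus)
  have trL: "trace (L w) = 0" for w
    by (simp add: L_def trace_scaleR trace_add a(3) trace_uminus trace_metric_adjoint[OF S] trJ)
  \<comment> \<open>The Ricci trace runs over \<open>u\<close>, so every term is rewritten as an
    endomorphism applied to \<open>u\<close>.\<close>
  have "(\<lambda>u. riemann_curvature (bracket_of a) S u v w)
      = (\<lambda>u. (L (D v w) - (L v + a v) ** L w + L w ** a v) *v u)"
  proof
    fix u
    have "riemann_curvature (bracket_of a) S u v w = D u (D v w) - D v (D u w) - D (bracket_of a u v) w"
      by (simp add: riemann_curvature_def D_def Let_def)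
    also have "\<dots> = L (D v w) *v u - (L v + a v) *v (L w *v u) - L w *v (- (a v *v u))"
      unfolding DL[of u] DR[of v "L w *v u"] DL[of "bracket_of a u v"]
      unfolding bracket_of_def a(2)[of u v] ..
    finally show "riemann_curvature (bracket_of a) S u v w
        = (L (D v w) - (L v + a v) ** L w + L w ** a v) *v u"
      by (simp add: matrix_vector_simps matrix_vector_mul_assoc)
  qed
  then have "ricci_form (bracket_of a) S v w = trace (L (D v w) - (L v + a v) ** L w + L w ** a v)"
    by (simp add: ricci_form_def)
  \<comment> \<open>The term \<open>L (D v w)\<close> is trace-free, and the two products of
    \<open>a v\<close> and \<open>L w\<close> have equal traces with opposite signs.\<close>
  also have "\<dots> = - trace (L v ** L w)"
    using trace_mul_sym[of "a v" "L w"] by (simp add: matrix_mult_simps trace_add trace_sub trL)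
  also have "\<dots> = - (1/4) * trace ((a v + ?t (a v) + ?J v) ** (a w + ?t (a w) + ?J w))"
    by (simp add: L_def matrix_mult_simps(7,8) trace_scaleR trace_uminus del: scaleR_minus_left)
  \<comment> \<open>The vanishing Killing form removes \<open>a v ** a w\<close> and, after taking
    adjoints, \<open>?t (a v) ** ?t (a w)\<close>. The mixed terms with \<open>?J\<close> cancel
    because \<open>a x + ?t (a x)\<close> is self-adjoint and \<open>?J y\<close> is skew.\<close>
  also have "trace ((a v + ?t (a v) + ?J v) ** (a w + ?t (a w) + ?J w))
      = 2 * trace (a v ** ?t (a w)) + trace (?J v ** ?J w)"
  proof -
    have tr_t: "trace (?t A ** B) = trace (?t B ** A)" for A B
      using trace_metric_adjoint[OF S, of "?t A ** B"]
      by (simp add: metric_adjoint_mult[OF S] metric_adjoint_involutive[OF S])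
    have k: "trace (a v ** a w) = 0" for v w
    proof -
      have "bracket_of a v \<circ> bracket_of a w = (\<lambda>x. (a v ** a w) *v x)"
        by (auto simp: bracket_of_def matrix_vector_mul_assoc)
      then show ?thesis using kill[of v w] by (simp add: killing_form_def)
    qed
    have kt: "trace (?t (a v) ** ?t (a w)) = 0"
      using trace_metric_adjoint[OF S, of "a w ** a v"] by (simp add: metric_adjoint_mult[OF S] k)
    have "trace (?t (a x) ** ?J y) = - trace (a x ** ?J y)" for x y
      using tr_t[of "a x" "?J y"] trace_mul_sym[of "a x"]
      by (simp add: metric_adjoint_ad_swap[OF aV S] matrix_mult_simps trace_uminus)
    moreover have "trace (?t (a v) ** a w) = trace (a v ** ?t (a w))"
      using tr_t[of "a v" "a w"] trace_mul_sym[of "a v"] by simp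
    ultimately show ?thesis
      using trace_mul_sym[of "?J v" "a w"] trace_mul_sym[of "?J v" "?t (a w)"]
      by (simp add: matrix_mult_simps trace_add k kt)
  qed
  finally show ?thesis by (simp add: field_simps)
qed

section \<open>The Ricci operator in terms of \<open>q\<close>\<close>

text \<open>Symmetry of \<open>matrix_inv S\<close> makes the coefficients in \<open>q\<close> the
  coordinates of \<open>matrix_inv S *v \<alpha>\<close>, and linearity of \<open>a\<close> collects
  the sum.\<close>

lemma q_eq_metric_adjoint:
  fixes a :: "real^'n \<Rightarrow> real^'n^'n"
  assumes lin: "linear a" and S: "S \<in> scalar_products"
  shows "q a S \<alpha> = metric_adjoint S (a (matrix_inv S *v \<alpha>))"
proof -
  let ?T = "matrix_inv S"
  have c: "\<alpha> \<bullet> (?T *v axis i 1) = (?T *v \<alpha>) $ i" for i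
    using inner_matrix_vector_left[of ?T \<alpha> "axis i 1"]
    by (simp add: scalar_product_inverse[OF S] inner_axis)
  have "linear (\<lambda>v. metric_adjoint S (a v))"
    by (rule linearI) (simp_all add: linear_add[OF lin] linear_scale[OF lin] metric_adjoint_simps)
  note l = linear_sum[OF this] linear_scale[OF this]
  have "?T *v \<alpha> = (\<Sum>i\<in>UNIV. (?T *v \<alpha>) $ i *\<^sub>R axis i 1)"
    using basis_expansion[of "?T *v \<alpha>"] by (simp add: scalar_mult_eq_scaleR)
  then have "metric_adjoint S (a (?T *v \<alpha>))
      = (\<Sum>i\<in>UNIV. (?T *v \<alpha>) $ i *\<^sub>R metric_adjoint S (a (axis i 1)))"
    using l(1)[of "\<lambda>i. (?T *v \<alpha>) $ i *\<^sub>R axis i 1" UNIV] by (simp add: l(2))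
  then show ?thesis by (simp add: q_def c metric_adjoint_def)
qed

text \<open>Bilinearity ensures that the matrix \<open>ric a S\<close> acts by its defining formula
  and that basis values recover the Ricci form. The symmetric matrix \<open>matrix_inv S\<close>
  then moves to the second slot.\<close>

lemma gl_pairing_ric_eq_sum:
  fixes a :: "real^'n \<Rightarrow> real^'n^'n"
  assumes S: "S \<in> scalar_products" and bil: "bilinear (ricci_form (bracket_of a) S)"
  shows "gl_pairing (ric a S) X
    = (\<Sum>j\<in>UNIV. ricci_form (bracket_of a) S (X *v axis j 1) (matrix_inv S *v axis j 1))"
proof -
  let ?R = "ricci_form (bracket_of a) S" and ?T = "matrix_inv S"
  have r: "linear (?R x)" and l: "linear (\<lambda>x. ?R x y)" for x y using bil by (auto simp: bilinear_def)
  have coord: "(\<chi> i. ?R v (axis i 1)) \<bullet> w = ?R v w" for v w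
  proof -
    have "w = (\<Sum>i\<in>UNIV. w $ i *\<^sub>R axis i 1)"
      using basis_expansion[of w] by (simp add: scalar_mult_eq_scaleR)
    then have "?R v w = (\<Sum>i\<in>UNIV. w $ i * ?R v (axis i 1))"
      using linear_sum[OF r, of v "\<lambda>i. w $ i *\<^sub>R axis i 1" UNIV] by (simp add: linear_scale[OF r])
    then show ?thesis by (simp add: inner_vec_def mult.commute)
  qed
  have "linear (\<lambda>v. ?T *v (\<chi> i. ?R v (axis i 1)))"
    by (rule linearI) (simp_all add: linear_add[OF l] linear_scale[OF l] vec_eq_iff
        matrix_vector_mult_def algebra_simps sum.distrib sum_distrib_left)
  then have "ric a S *v v = ?T *v (\<chi> i. ?R v (axis i 1))" for v
    unfolding ric_def by (rule fun_cong[OF matrix_vector_mul(2)])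
  then show ?thesis
    unfolding gl_pairing_def trace_eq_sum_inner
    by (simp add: matrix_vector_mul_assoc[symmetric] inner_matrix_vector_left
        scalar_product_inverse[OF S] coord)
qed

lemma bilinear_ricci_form:
  fixes a :: "real^'n \<Rightarrow> real^'n^'n"
  assumes aV: "a \<in> V11_1" and S: "S \<in> scalar_products"
    and kill: "\<And>v w. killing_form (bracket_of a) v w = 0"
  shows "bilinear (ricci_form (bracket_of a) S)"
proof -
  note a = V11_1_D[OF aV]
  have J: "metric_ad_swap a S (u + v) = metric_ad_swap a S u + metric_ad_swap a S v"
    "metric_ad_swap a S (c *\<^sub>R u) = c *\<^sub>R metric_ad_swap a S u" for c u v
    by (simp_all add: matrix_eq metric_ad_swap_apply[OF a(1)] matrix_vector_simps)
  show ?thesis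
    unfolding bilinear_def
    by (intro conjI allI linearI)
      (simp_all add: ricci_form_killing_null[OF assms] linear_add[OF a(1)] linear_scale[OF a(1)] J
        metric_adjoint_simps matrix_mult_simps trace_add trace_scaleR algebra_simps)
qed

text \<open>Both sides are double sums over basis indices \<open>i\<close> and \<open>j\<close>. One
  use of \<open>a v *v w = - (a w *v v)\<close> matches the summands and produces the sign;
  exchanging the order of summation does the rest.\<close>

lemma sum_trace_ad_swap:
  fixes a :: "real^'n \<Rightarrow> real^'n^'n"
  assumes aV: "a \<in> V11_1" and S: "S \<in> scalar_products"
  shows "(\<Sum>j\<in>UNIV. trace (metric_ad_swap a S (X *v axis j 1) ** metric_ad_swap a S (matrix_inv S *v axis j 1)))
    = - (\<Sum>i\<in>UNIV. trace (X ** a (axis i 1) ** q a S (axis i 1)))"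
proof -
  note a = V11_1_D[OF aV] and S' = scalar_product_inverse[OF S]
  let ?T = "matrix_inv S" and ?e = "\<lambda>i::'n. axis i 1 :: real^'n"
  have "(metric_ad_swap a S (X *v ?e j) ** metric_ad_swap a S (?T *v ?e j) *v ?e i) \<bullet> ?e i
      = - ((transpose X ** S ** a (?T *v ?e i) ** ?T ** transpose (a (?e i)) *v ?e j) \<bullet> ?e j)" for i j
  proof -
    \<comment> \<open>This is the inner vector \<open>J (?T *v ?e j) *v ?e i\<close>: the factor
      \<open>S\<close> of the adjoint cancels \<open>?T\<close>.\<close>
    define x where "x = ?T *v (transpose (a (?e i)) *v ?e j)"
    have "metric_ad_swap a S (?T *v ?e j) *v ?e i = ?T ** transpose (a (?e i)) ** (S ** ?T) *v ?e j"
      by (simp only: metric_ad_swap_apply[OF a(1)] metric_adjoint_def matrix_vector_mul_assoc matrix_mul_assoc)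
    then have 1: "metric_ad_swap a S (?T *v ?e j) *v ?e i = x"
      by (simp only: S' x_def matrix_vector_mul_assoc matrix_mul_rid)
    have "(metric_ad_swap a S (X *v ?e j) ** metric_ad_swap a S (?T *v ?e j) *v ?e i) \<bullet> ?e i
       = (?T *v (transpose (a x) *v (S *v (X *v ?e j)))) \<bullet> ?e i"
        unfolding matrix_vector_mul_assoc[symmetric, of "metric_ad_swap a S (X *v ?e j)"] 1
      by (simp only: metric_ad_swap_apply[OF a(1)] metric_adjoint_def matrix_vector_mul_assoc matrix_mul_assoc)
    also have "\<dots> = ?e j \<bullet> (transpose X *v (S *v (a x *v (?T *v ?e i))))"
      by (simp only: inner_matrix_vector_left S' transpose_transpose)
    \<comment> \<open>Antisymmetry moves \<open>x\<close>, which depends on \<open>j\<close>, out of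
      the argument of \<open>a\<close>, so that the expression becomes a diagonal entry in
      \<open>j\<close>.\<close>
    also have "\<dots> = - (?e j \<bullet> (transpose X *v (S *v (a (?T *v ?e i) *v x))))"
      by (subst a(2)) (simp add: matrix_vector_simps)
    finally show ?thesis
      by (simp only: x_def matrix_vector_mul_assoc matrix_mul_assoc inner_commute[of "?e j"])
  qed
  then have "(\<Sum>j\<in>UNIV. trace (metric_ad_swap a S (X *v ?e j) ** metric_ad_swap a S (?T *v ?e j)))
     = - (\<Sum>i\<in>UNIV. trace (transpose X ** S ** a (?T *v ?e i) ** ?T ** transpose (a (?e i))))"
    unfolding trace_eq_sum_inner
    by (subst (2) sum.swap) (simp add: sum_negf)
  moreover have "trace (transpose X ** S ** a (?T *v ?e i) ** ?T ** transpose (a (?e i)))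
     = trace (X ** a (?e i) ** q a S (?e i))" for i
  proof -
    have "trace (transpose X ** (S ** a (?T *v ?e i) ** ?T ** transpose (a (?e i))))
        = trace ((S ** a (?T *v ?e i) ** ?T ** transpose (a (?e i))) ** transpose X)"
      by (rule trace_mul_sym)
    also have "\<dots> = trace (transpose (X ** a (?e i) ** q a S (?e i)))"
      by (simp only: q_eq_metric_adjoint[OF a(1) S] metric_adjoint_def matrix_transpose_mul S'
          transpose_transpose matrix_mul_assoc)
    finally show ?thesis by (simp only: trace_transpose matrix_mul_assoc)
  qed
  ultimately show ?thesis by simp
qed

text \<open>Written as double sums, the summands correspond by antisymmetry applied in each of the
  two factors: the signs cancel and the indices \<open>i\<close> and \<open>j\<close> exchange
  roles.\<close>

lemma sum_trace_ad_conj: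
  fixes a :: "real^'n \<Rightarrow> real^'n^'n"
  assumes aV: "a \<in> V11_1" and S: "S \<in> scalar_products"
  shows "(\<Sum>i\<in>UNIV. trace (a (axis i 1) ** X ** q a S (axis i 1)))
    = (\<Sum>i\<in>UNIV. trace (a (X *v axis i 1) ** q a S (axis i 1)))"
proof -
  note a = V11_1_D[OF aV] and S' = scalar_product_inverse[OF S]
  let ?T = "matrix_inv S" and ?e = "\<lambda>i::'n. axis i 1 :: real^'n"
  have tr: "trace (A ** q a S (?e i)) = (\<Sum>j\<in>UNIV. (S *v (A *v ?e j)) \<bullet> (a (?T *v ?e i) *v (?T *v ?e j)))"
    for A i
  proof -
    have "trace (A ** q a S (?e i)) = trace (transpose (A ** q a S (?e i)))"
      by (simp add: trace_transpose)
    also have "transpose (A ** q a S (?e i)) = (S ** a (?T *v ?e i) ** ?T) ** transpose A"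
      by (simp only: q_eq_metric_adjoint[OF a(1) S] metric_adjoint_def matrix_transpose_mul S'
          transpose_transpose matrix_mul_assoc)
    also have "trace \<dots> = trace (transpose A ** (S ** a (?T *v ?e i) ** ?T))"
      by (rule trace_mul_sym)
    also have "\<dots> = (\<Sum>j\<in>UNIV. (transpose A *v (S *v (a (?T *v ?e i) *v (?T *v ?e j)))) \<bullet> ?e j)"
      by (simp only: trace_eq_sum_inner matrix_vector_mul_assoc matrix_mul_assoc)
    finally show ?thesis
      by (simp only: inner_matrix_vector_left S' transpose_transpose inner_commute)
  qed
  have "(S *v ((a (?e i) ** X) *v ?e j)) \<bullet> (a (?T *v ?e i) *v (?T *v ?e j))
      = (S *v (a (X *v ?e j) *v ?e i)) \<bullet> (a (?T *v ?e j) *v (?T *v ?e i))" for i j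
    unfolding matrix_vector_mul_assoc[symmetric] a(2)[of "?e i"] a(2)[of "?T *v ?e i"]
    by (simp add: matrix_vector_simps)
  then show ?thesis unfolding tr by (subst sum.swap) simp
qed

text \<open>The skew part of the Ricci form yields the contribution of \<open>X ** a v\<close> to
  \<open>inf_act X a v\<close>. The other two, from \<open>a v ** X\<close> and
  \<open>a (X *v v)\<close>, have equal sums, which turns the coefficient \<open>1/2\<close> into
  twice \<open>1/4\<close>.\<close>

lemma gl_pairing_ric:
  fixes a :: "real^'n \<Rightarrow> real^'n^'n"
  assumes a: "a \<in> killing_null_brackets" and S: "S \<in> scalar_products"
  shows "gl_pairing (ric a S) X = 1 / 4 * duality (inf_act X a) (q a S)"
proof -
  have aV: "a \<in> V11_1" and kill: "\<And>v w. killing_form (bracket_of a) v w = 0"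
    using a by (auto simp: killing_null_brackets_def)
  note lin = V11_1_D(1)[OF aV]
  let ?e = "\<lambda>i::'n. axis i 1 :: real^'n"
  have "gl_pairing (ric a S) X = (\<Sum>j\<in>UNIV.
      - (1/2) * trace (a (X *v ?e j) ** q a S (?e j))
      - (1/4) * trace (metric_ad_swap a S (X *v ?e j) ** metric_ad_swap a S (matrix_inv S *v ?e j)))"
    by (simp add: gl_pairing_ric_eq_sum[OF S bilinear_ricci_form[OF aV S kill]]
        ricci_form_killing_null[OF aV S kill] q_eq_metric_adjoint[OF lin S])
  also have "\<dots> = - (1/2) * (\<Sum>j\<in>UNIV. trace (a (X *v ?e j) ** q a S (?e j)))
      + (1/4) * (\<Sum>i\<in>UNIV. trace (X ** a (?e i) ** q a S (?e i)))"
    using sum_trace_ad_swap[OF aV S, of X]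
    by (simp only: sum_subtractf sum_distrib_left[symmetric])
  finally show ?thesis
    using sum_trace_ad_conj[OF aV S, of X]
    by (simp add: duality_def inf_act_formula(2)[OF lin] matrix_mult_simps trace_sub trace_add sum_subtractf sum.distrib field_simps)
qed

section \<open>Scalar curvature and its derivative along \<open>GL(T)\<close> orbits\<close>

lemma scal_eq_duality:
  fixes a :: "real^'n \<Rightarrow> real^'n^'n"
  assumes a: "a \<in> killing_null_brackets" and S: "S \<in> scalar_products"
  shows "scal a S = - (1 / 4) * duality a (q a S)"
proof -
  have "linear a" using a V11_1_D(1) by (auto simp: killing_null_brackets_def)
  then have "inf_act (mat 1) a = (\<lambda>v. - a v)" by (auto simp: inf_act_formula(2))
  then show ?thesis
    using gl_pairing_ric[OF a S, of "mat 1"]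
    by (simp add: gl_pairing_def scal_def duality_def matrix_mult_simps trace_uminus sum_negf)
qed

text \<open>The new bracket is the old one transported by the isomorphism \<open>g\<close>. This
  keeps the curve through \<open>a\<close> inside the set where the quadratic formula for
  \<open>scal\<close> is available.\<close>

lemma gl_act_killing_null_brackets:
  fixes a :: "real^'n \<Rightarrow> real^'n^'n"
  assumes a: "a \<in> killing_null_brackets" and g: "invertible g"
  shows "gl_act g a \<in> killing_null_brackets"
proof -
  have aV: "a \<in> V11_1" and kill: "\<And>v w. killing_form (bracket_of a) v w = 0"
    and jac: "\<And>u v w. bracket_of a u (bracket_of a v w) + bracket_of a v (bracket_of a w u)
      + bracket_of a w (bracket_of a u v) = 0"
    using a by (auto simp: killing_null_brackets_def lie_bracket_def)
  note a = V11_1_D[OF aV]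
  define h where "h = matrix_inv g"
  have gh: "g ** h = mat 1" and hg: "h ** g = mat 1" using matrix_inv_mult[OF g] by (auto simp: h_def)
  have hgv: "h *v (g *v x) = x" for x by (simp add: matrix_vector_mul_assoc hg)
  have tr: "trace (g ** A ** h) = trace A" for A
    using trace_mul_sym[of "g ** A" h] by (simp add: matrix_mul_assoc hg)
  have b: "bracket_of (gl_act g a) v w = g *v bracket_of a (h *v v) (h *v w)" for v w
    by (simp add: bracket_of_def gl_act_def h_def matrix_vector_mul_assoc matrix_mul_assoc)
  have lin: "linear (gl_act g a)"
    by (rule linearI) (simp_all add: gl_act_def linear_add[OF a(1)] linear_scale[OF a(1)]
        matrix_vector_simps matrix_mult_simps)
  have skew: "gl_act g a v *v w = - (gl_act g a w *v v)" for v w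
    using b[of v w] b[of w v] a(2)[of "h *v v" "h *v w"] by (simp add: bracket_of_def matrix_vector_simps)
  have "trace (gl_act g a v) = 0" for v
    by (simp add: gl_act_def h_def[symmetric] tr a(3))
  with lin skew have "gl_act g a \<in> V11_1" unfolding V11_1_def by blast
  moreover have "lie_bracket (bracket_of (gl_act g a))"
    unfolding lie_bracket_def
  proof (intro conjI allI)
    show "bilinear (bracket_of (gl_act g a))"
      unfolding bilinear_def
      by (intro conjI allI linearI)
       (simp_all add: bracket_of_def linear_add[OF lin] linear_scale[OF lin] matrix_vector_simps)
    show "bracket_of (gl_act g a) v v = 0" for v
      using skew[of v v] by (simp add: bracket_of_def vec_eq_iff)
    show "bracket_of (gl_act g a) u (bracket_of (gl_act g a) v w)
        + bracket_of (gl_act g a) v (bracket_of (gl_act g a) w u)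
        + bracket_of (gl_act g a) w (bracket_of (gl_act g a) u v) = 0" for u v w
      using arg_cong[OF jac[of "h *v u" "h *v v" "h *v w"], of "\<lambda>x. g *v x"]
      by (simp add: b hgv matrix_vector_simps)
  qed
  moreover have "killing_form (bracket_of (gl_act g a)) v w = 0" for v w
  proof -
    have k: "killing_form (bracket_of c) v w = trace (c v ** c w)" for c :: "real^'n \<Rightarrow> real^'n^'n" and v w
    proof -
      have "bracket_of c v \<circ> bracket_of c w = (\<lambda>x. (c v ** c w) *v x)"
        by (auto simp: bracket_of_def matrix_vector_mul_assoc)
      then show ?thesis by (simp add: killing_form_def)
    qed
    \<comment> \<open>The inner \<open>h ** g\<close> cancels, so the new Killing form is the old
      one pulled back by \<open>h\<close>.\<close>
    have "gl_act g a v ** gl_act g a w = g ** (a (h *v v) ** (h ** g) ** a (h *v w)) ** h"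
      by (simp only: gl_act_def h_def matrix_mul_assoc)
    then show ?thesis using kill[of "h *v v" "h *v w"] by (simp add: k tr hg)
  qed
  ultimately show ?thesis by (simp add: killing_null_brackets_def)
qed

text \<open>The determinant tends to 1 as \<open>t\<close> tends to 0. The filter
  \<open>nhds 0\<close> includes \<open>t = 0\<close>, since replacing a function in a derivative
  requires agreement at the point too.\<close>

lemma eventually_invertible_mexp:
  fixes X :: "real^'n^'n"
  shows "\<forall>\<^sub>F t in nhds 0. invertible (mexp (t *\<^sub>R X))"
proof -
  have "((\<lambda>t. det (mexp (t *\<^sub>R X))) \<longlongrightarrow> det (mat 1 :: real^'n^'n)) (at 0)"
    unfolding det_def by (intro tendsto_intros tendsto_vec_nth mexp_tendsto)
  then have "\<forall>\<^sub>F t in at 0. det (mexp (t *\<^sub>R X)) \<noteq> 0"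
    by (rule tendsto_imp_eventually_ne) simp
  then show ?thesis by (simp add: eventually_nhds_conv_at mexp_0 invertible_det_nz)
qed

text \<open>Near \<open>t = 0\<close> the function is \<open>-1/4\<close> times a quadratic form in
  the moving bracket; the product rule gives two equal terms, hence the factor
  \<open>-1/2\<close>.\<close>

lemma scal_gl_act_has_derivative:
  fixes a :: "real^'n \<Rightarrow> real^'n^'n"
  assumes a: "a \<in> killing_null_brackets" and S: "S \<in> scalar_products"
  shows "((\<lambda>t. scal (gl_act (mexp (t *\<^sub>R X)) a) S) has_real_derivative
    - (1 / 2) * duality (inf_act X a) (q a S)) (at 0)"
proof -
  have aV: "a \<in> V11_1" using a by (auto simp: killing_null_brackets_def)
  note lin = V11_1_D(1)[OF aV]
  interpret M: bounded_bilinear "(**) :: real^'n^'n \<Rightarrow> real^'n^'n \<Rightarrow> real^'n^'n"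
    by (rule bilinear_matrix_mult)
  let ?e = "\<lambda>i::'n. axis i 1 :: real^'n" and ?T = "matrix_inv S" and ?t = "metric_adjoint S"
  define c where "c t = gl_act (mexp (t *\<^sub>R X)) a" for t
  define d where "d = inf_act X a"
  have c0: "c 0 v = a v" for v
  proof -
    have "matrix_inv (mat 1) = (mat 1 :: real^'n^'n)"
      using matrix_inv_mult(1)[of "mat 1 :: real^'n^'n"] by (simp add: invertible_def exI[of _ "mat 1"])
    then show ?thesis by (simp add: c_def gl_act_def mexp_0)
  qed
  have dlin: "linear d"
    by (rule linearI) (simp_all add: d_def inf_act_formula(2)[OF lin] linear_add[OF lin] linear_scale[OF lin]
        matrix_vector_simps matrix_mult_simps scaleR_diff_right)
  have dc: "((\<lambda>t. c t v) has_vector_derivative d v) (at 0)" for v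
    using inf_act_formula[OF lin, of X v] by (simp add: c_def d_def)
  have "linear ?t" by (rule linearI) (simp_all add: metric_adjoint_simps)
  then have bt: "bounded_linear ?t" by (simp add: linear_conv_bounded_linear)
  have "linear (trace :: real^'n^'n \<Rightarrow> real)" by (rule linearI) (simp_all add: trace_add trace_scaleR)
  then have btr: "bounded_linear (trace :: real^'n^'n \<Rightarrow> real)" by (simp add: linear_conv_bounded_linear)
  let ?Q = "\<lambda>c. \<Sum>i\<in>UNIV. trace (c (?e i) ** ?t (c (?T *v ?e i)))"
  have "((\<lambda>t. ?Q (c t)) has_vector_derivative (\<Sum>i\<in>UNIV.
      trace (c 0 (?e i) ** ?t (d (?T *v ?e i)) + d (?e i) ** ?t (c 0 (?T *v ?e i))))) (at 0)"
    by (intro has_vector_derivative_sum bounded_linear.has_vector_derivative[OF btr]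
        M.has_vector_derivative bounded_linear.has_vector_derivative[OF bt] dc)
  moreover have "(\<Sum>i\<in>UNIV. trace (c 0 (?e i) ** ?t (d (?T *v ?e i)) + d (?e i) ** ?t (c 0 (?T *v ?e i))))
     = 2 * duality d (q a S)"
  proof -
    \<comment> \<open>Symmetry of the quadratic form: this exchanges \<open>a\<close> and
      \<open>d\<close>, after which \<open>?T\<close> has to change slots.\<close>
    have tr_t: "trace (A ** ?t B) = trace (B ** ?t A)" for A B
      using trace_metric_adjoint[OF S, of "A ** ?t B"]
      by (simp add: metric_adjoint_mult[OF S] metric_adjoint_involutive[OF S])
    have "bilinear (\<lambda>v w. trace (d v ** ?t (a w)))"
      unfolding bilinear_def
      by (intro conjI allI linearI)
       (simp_all add: linear_add[OF lin] linear_scale[OF lin] linear_add[OF dlin] linear_scale[OF dlin]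
          metric_adjoint_simps matrix_mult_simps trace_add trace_scaleR algebra_simps)
    from sum_bilinear_transfer[OF this, of ?T]
    show ?thesis
      by (simp add: c0 trace_add sum.distrib tr_t[of "a _"] duality_def q_eq_metric_adjoint[OF lin S]
          scalar_product_inverse[OF S])
  qed
  ultimately have "((\<lambda>t. ?Q (c t)) has_real_derivative 2 * duality d (q a S)) (at 0)"
    by (simp add: has_real_derivative_iff_has_vector_derivative)
  then have "((\<lambda>t. - (1/4) * ?Q (c t)) has_real_derivative - (1/4) * (2 * duality d (q a S))) (at 0)"
    by (rule DERIV_cmult)
  \<comment> \<open>Wherever \<open>mexp (t *\<^sub>R X)\<close> is invertible, \<open>c t\<close>
    is again a bracket with zero Killing form, so \<open>scal_eq_duality\<close> applies to
    it.\<close>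
  moreover have "\<forall>\<^sub>F t in nhds 0. scal (c t) S = - (1/4) * ?Q (c t)"
    using eventually_invertible_mexp[of X]
  proof eventually_elim
    case (elim t)
    then have ct: "c t \<in> killing_null_brackets"
      unfolding c_def by (rule gl_act_killing_null_brackets[OF a])
    then have "linear (c t)" using V11_1_D(1) by (auto simp: killing_null_brackets_def)
    then show ?case by (simp add: scal_eq_duality[OF ct S] duality_def q_eq_metric_adjoint[OF _ S])
  qed
  ultimately have "((\<lambda>t. scal (c t) S) has_real_derivative - (1/4) * (2 * duality d (q a S))) (at 0)"
    by (subst DERIV_cong_ev[OF refl _ refl])
  then show ?thesis by (simp add: c_def d_def)
qed

theorem theorem3p8:
  fixes a :: "real^'n \<Rightarrow> real^'n^'n" and S :: "real^'n^'n"
  assumes "a \<in> killing_null_brackets" and "S \<in> scalar_products"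
  shows "(\<forall>X. gl_pairing (ric a S) X = 1 / 4 * duality (inf_act X a) (q a S))
       \<and> (\<forall>X. (\<lambda>t. scal (gl_act (mexp (t *\<^sub>R X)) a) S) differentiable (at 0)
             \<and> gl_pairing (ric a S) X = - (1 / 2) * fundamental_deriv X scal a S)"
proof (intro conjI allI)
  fix X :: "real^'n^'n"
  note d = scal_gl_act_has_derivative[OF assms, of X]
  show "gl_pairing (ric a S) X = 1 / 4 * duality (inf_act X a) (q a S)"
    by (rule gl_pairing_ric[OF assms])
  show "(\<lambda>t. scal (gl_act (mexp (t *\<^sub>R X)) a) S) differentiable (at 0)"
    using d by (auto simp: real_differentiable_def)
  show "gl_pairing (ric a S) X = - (1 / 2) * fundamental_deriv X scal a S"
    using DERIV_imp_deriv[OF d] by (simp add: fundamental_deriv_def gl_pairing_ric[OF assms])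
qed

end
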